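(* Let $\mathcal{X}\subset\mathbb{R}^n$ be compact and convex, and let $f$ be $\alpha$-strongly convex and $\beta$-smooth on $\mathcal{X}$, with $\alpha,\beta>0$, and let $\kappa=\beta/\alpha$. Let $x^*$ be the minimizer of $f$ on $\mathcal{X}$, $x_1\in\mathcal{X}$, and let projected gradient descent with $\eta=\frac1\beta$ be defined by $x_{s+1}=\Pi_{\mathcal{X}}(x_s-\eta\nabla f(x_s))$, $s\ge 1$. Then for every $t\ge 0$, $$\|x_{t+1}-x^*\|^2\le\exp\left(-\frac t\kappa\right)\|x_1-x^*\|^2.$$
   Context: $\|\cdot\|$ is the Euclidean norm and $\Pi_{\mathcal{X}}(x)=\mathrm{argmin}_{y\in\mathcal{X}}\|x-y\|$. A continuously differentiable $f$ is $\beta$-smooth on $\mathcal{X}$ if $\|\nabla f(x)-\nabla f(y)\|\le\beta\|x-y\|$ for all $x,y\in\mathcal{X}$, and $\alpha$-strongly convex if $f(x)-f(y)\le\nabla f(x)^\top(x-y)-\frac\alpha2\|x-y\|^2$ for all $x,y\in\mathcal{X}$. *)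

theory Defs
  imports "HOL-Analysis.Analysis"
begin

text \<open>
  Here \<open>g\<close> plays the role of the gradient of \<open>f\<close>. The derivative is taken relative to \<open>X\<close>, so that
  nothing is assumed about \<open>f\<close> outside \<open>X\<close>; a function that is continuously differentiable on a
  neighbourhood of \<open>X\<close> satisfies this with its ordinary gradient. If \<open>X\<close> has empty interior, \<open>g\<close> need
  not be unique.
\<close>
definition cont_gradient_on ::
  "'a::real_inner set \<Rightarrow> ('a \<Rightarrow> real) \<Rightarrow> ('a \<Rightarrow> 'a) \<Rightarrow> bool" where
  "cont_gradient_on X f g \<longleftrightarrow>
     (\<forall>x\<in>X. (f has_derivative (\<lambda>h. g x \<bullet> h)) (at x within X)) \<and> continuous_on X g"

definition beta_smooth_on ::
  "real \<Rightarrow> 'a::real_inner set \<Rightarrow> ('a \<Rightarrow> real) \<Rightarrow> ('a \<Rightarrow> 'a) \<Rightarrow> bool" where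
  "beta_smooth_on \<beta> X f g \<longleftrightarrow> cont_gradient_on X f g \<and>
     (\<forall>x\<in>X. \<forall>y\<in>X. norm (g x - g y) \<le> \<beta> * norm (x - y))"

definition strongly_convex_on ::
  "real \<Rightarrow> 'a::real_inner set \<Rightarrow> ('a \<Rightarrow> real) \<Rightarrow> ('a \<Rightarrow> 'a) \<Rightarrow> bool" where
  "strongly_convex_on \<alpha> X f g \<longleftrightarrow> cont_gradient_on X f g \<and>
     (\<forall>x\<in>X. \<forall>y\<in>X. f x - f y \<le> g x \<bullet> (x - y) - \<alpha> / 2 * (norm (x - y))\<^sup>2)"

text \<open>The iterates are numbered from 1; the value \<open>x 0\<close> is irrelevant.\<close>
definition projected_gradient_descent ::
  "'a::euclidean_space set \<Rightarrow> ('a \<Rightarrow> 'a) \<Rightarrow> real \<Rightarrow> (nat \<Rightarrow> 'a) \<Rightarrow> bool" where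
  "projected_gradient_descent X g \<eta> x \<longleftrightarrow>
     x 1 \<in> X \<and> (\<forall>s\<ge>1. x (s + 1) = closest_point X (x s - \<eta> *\<^sub>R g (x s)))"

end

theory Submission
  imports Defs
begin

text \<open>
  One step of the method contracts the squared distance to the minimizer \<open>x\<^sup>*\<close> by the factor
  \<open>1 - \<alpha> / \<beta>\<close>, and \<open>1 - \<alpha> / \<beta> \<le> exp (- \<alpha> / \<beta>)\<close>. For the contraction, let \<open>p\<close> be the iterate that
  follows \<open>x\<close>. Smoothness bounds \<open>f p - f x\<close> from above by a quadratic model at \<open>x\<close>, strong
  convexity bounds \<open>f x - f x\<^sup>*\<close>, and the sum of the two is
  \<open>f p - f x\<^sup>* \<le> g x \<bullet> (p - x\<^sup>*) + \<beta> / 2 * \<parallel>p - x\<parallel>\<^sup>2 - \<alpha> / 2 * \<parallel>x - x\<^sup>*\<parallel>\<^sup>2\<close>.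
  The variational inequality for the projection replaces the gradient term by
  \<open>\<beta> * ((x - p) \<bullet> (p - x\<^sup>*))\<close>, and the law of cosines for the triangle \<open>x, p, x\<^sup>*\<close> then makes
  \<open>\<parallel>p - x\<parallel>\<^sup>2\<close> cancel, exactly because the step size is \<open>1 / \<beta>\<close>. What remains is
  \<open>f p - f x\<^sup>* \<le> (\<beta> - \<alpha>) / 2 * \<parallel>x - x\<^sup>*\<parallel>\<^sup>2 - \<beta> / 2 * \<parallel>p - x\<^sup>*\<parallel>\<^sup>2\<close>, and the left side is nonnegative
  because \<open>x\<^sup>*\<close> is a minimizer.
\<close>

text \<open>
  Along the segment from \<open>x\<close> to \<open>p\<close>, the difference between \<open>f\<close> and its quadratic model has
  derivative \<open>(g (x + t d) - g x) \<bullet> d - \<beta> t \<parallel>d\<parallel>\<^sup>2\<close> with \<open>d = p - x\<close>, which is nonpositive by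
  Cauchy-Schwarz and the Lipschitz bound. Convexity of \<open>X\<close> keeps the segment where \<open>f\<close> is known to be
  differentiable.
\<close>
lemma beta_smooth_on_imp_quadratic_upper_bound:
  fixes X :: "'a::real_inner set"
  assumes "convex X" and smooth: "beta_smooth_on \<beta> X f g" and x: "x \<in> X" and p: "p \<in> X"
  shows "f p \<le> f x + g x \<bullet> (p - x) + \<beta> / 2 * (norm (p - x))\<^sup>2"
proof -
  define d where "d = p - x"
  define seg where "seg t = x + t *\<^sub>R d" for t :: real
  define \<phi> where "\<phi> t = f (seg t) - t * (g x \<bullet> d) - \<beta> / 2 * t\<^sup>2 * (norm d)\<^sup>2" for t
  define \<phi>' where "\<phi>' t = (g (seg t) - g x) \<bullet> d - \<beta> * t * (norm d)\<^sup>2" for t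
  have seg: "seg t \<in> X" if "t \<in> {0..1}" for t
  proof -
    have "seg t = (1 - t) *\<^sub>R x + t *\<^sub>R p"
      by (simp add: seg_def d_def algebra_simps)
    then show ?thesis
      using convexD_alt[OF \<open>convex X\<close> x p, of t] that by simp
  qed
  have deriv: "(\<phi> has_derivative (\<lambda>h. h * \<phi>' t)) (at t within {0..1})" if t: "t \<in> {0..1}" for t
  proof -
    have "(f has_derivative (\<lambda>h. g (seg t) \<bullet> h)) (at (seg t) within X)"
      using smooth seg[OF t] by (simp add: beta_smooth_on_def cont_gradient_on_def)
    then have "(f has_derivative (\<lambda>h. g (seg t) \<bullet> h)) (at (seg t) within seg ` {0..1})"
      by (rule has_derivative_subset) (use seg in auto)
    moreover have "(seg has_derivative (\<lambda>h. h *\<^sub>R d)) (at t within {0..1})"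
      unfolding seg_def by (auto intro!: derivative_eq_intros)
    ultimately have f_seg:
      "((\<lambda>t. f (seg t)) has_derivative (\<lambda>h. g (seg t) \<bullet> (h *\<^sub>R d))) (at t within {0..1})"
      using diff_chain_within[of seg "\<lambda>h. h *\<^sub>R d" t "{0..1}" f "\<lambda>h. g (seg t) \<bullet> h"]
      by (simp add: o_def)
    show ?thesis
      unfolding \<phi>_def \<phi>'_def
      by (rule derivative_eq_intros f_seg refl)+
        (auto simp: fun_eq_iff algebra_simps)
  qed
  have nonpos: "\<phi>' t \<le> 0" if t: "t \<in> {0..1}" for t
  proof -
    have "(g (seg t) - g x) \<bullet> d \<le> norm (g (seg t) - g x) * norm d"
      by (rule norm_cauchy_schwarz)
    also have "\<dots> \<le> (\<beta> * norm (seg t - x)) * norm d"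
      using smooth seg[OF t] x by (intro mult_right_mono) (auto simp: beta_smooth_on_def)
    also have "\<dots> = \<beta> * t * (norm d)\<^sup>2"
      using t by (simp add: seg_def power2_eq_square)
    finally show ?thesis
      by (simp add: \<phi>'_def)
  qed
  obtain t where t: "t \<in> {0<..<1}" and "\<phi> 1 - \<phi> 0 = (1 - 0) * \<phi>' t"
    using mvt_simple[of 0 1 \<phi>, OF _ deriv] by auto
  with nonpos[of t] have "\<phi> 1 \<le> \<phi> 0"
    by simp
  then show ?thesis
    by (simp add: \<phi>_def seg_def d_def)
qed

text \<open>
  For every \<open>z \<in> X\<close>, the vector from the projection of \<open>x - g x / \<beta>\<close> to that point itself makes
  an angle of at least a right angle with the vector to \<open>z\<close>; here \<open>z\<close> is the minimizer.
\<close>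
lemma projected_gradient_step_contraction:
  fixes X :: "'a::euclidean_space set"
  assumes "closed X" "convex X" and "\<beta> > 0"
    and sc: "strongly_convex_on \<alpha> X f g" and smooth: "beta_smooth_on \<beta> X f g"
    and min: "is_arg_min f (\<lambda>y. y \<in> X) x_star"
    and x: "x \<in> X" and p_def: "p = closest_point X (x - (1 / \<beta>) *\<^sub>R g x)"
  shows "(norm (p - x_star))\<^sup>2 \<le> (1 - \<alpha> / \<beta>) * (norm (x - x_star))\<^sup>2"
proof -
  have x_star: "x_star \<in> X"
    using min by (simp add: is_arg_min_def)
  have p: "p \<in> X"
    unfolding p_def using \<open>closed X\<close> x by (intro closest_point_in_set) auto
  have "(x - (1 / \<beta>) *\<^sub>R g x - p) \<bullet> (x_star - p) \<le> 0"
    unfolding p_def by (rule closest_point_dot[OF \<open>convex X\<close> \<open>closed X\<close> x_star])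
  then have "\<beta> * ((x - (1 / \<beta>) *\<^sub>R g x - p) \<bullet> (x_star - p)) \<le> 0"
    using \<open>\<beta> > 0\<close> by (simp add: mult_le_0_iff)
  moreover have "\<beta> * ((x - (1 / \<beta>) *\<^sub>R g x - p) \<bullet> (x_star - p))
      = g x \<bullet> (p - x_star) - \<beta> * ((x - p) \<bullet> (p - x_star))"
    using \<open>\<beta> > 0\<close> by (simp add: inner_diff_left inner_diff_right algebra_simps)
  ultimately have proj: "g x \<bullet> (p - x_star) \<le> \<beta> * ((x - p) \<bullet> (p - x_star))"
    by simp
  have "f x_star \<le> f p"
    using min p by (simp add: is_arg_min_linorder)
  moreover have "f p \<le> f x + g x \<bullet> (p - x) + \<beta> / 2 * (norm (p - x))\<^sup>2"
    by (rule beta_smooth_on_imp_quadratic_upper_bound[OF \<open>convex X\<close> smooth x p])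
  moreover have "f x - f x_star \<le> g x \<bullet> (x - x_star) - \<alpha> / 2 * (norm (x - x_star))\<^sup>2"
    using sc x x_star by (simp add: strongly_convex_on_def)
  moreover have "g x \<bullet> (p - x) + g x \<bullet> (x - x_star) = g x \<bullet> (p - x_star)"
    by (simp add: inner_diff_right)
  ultimately have "0 \<le> \<beta> * ((x - p) \<bullet> (p - x_star)) + \<beta> / 2 * (norm (p - x))\<^sup>2
      - \<alpha> / 2 * (norm (x - x_star))\<^sup>2"
    using proj by linarith
  also have "\<dots> = (\<beta> - \<alpha>) / 2 * (norm (x - x_star))\<^sup>2 - \<beta> / 2 * (norm (p - x_star))\<^sup>2"
    by (simp add: power2_norm_eq_inner inner_diff_left inner_diff_right inner_commute field_simps)
  finally have "\<beta> * (norm (p - x_star))\<^sup>2 \<le> (\<beta> - \<alpha>) * (norm (x - x_star))\<^sup>2"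
    by simp
  then show ?thesis
    using \<open>\<beta> > 0\<close> by (simp add: field_simps)
qed

lemma projected_gradient_descent_in_set:
  assumes "closed X" and pgd: "projected_gradient_descent X g \<eta> x"
  shows "x (t + 1) \<in> X"
proof (cases t)
  case 0
  then show ?thesis
    using pgd by (simp add: projected_gradient_descent_def)
next
  case (Suc s)
  have "X \<noteq> {}"
    using pgd by (auto simp: projected_gradient_descent_def)
  then show ?thesis
    using pgd Suc closest_point_in_set[OF \<open>closed X\<close>]
    by (simp add: projected_gradient_descent_def)
qed

theorem theorem3p10:
  fixes X :: "(real ^ 'n) set"
    and f :: "real ^ 'n \<Rightarrow> real"
    and grad_f :: "real ^ 'n \<Rightarrow> real ^ 'n"
    and x :: "nat \<Rightarrow> real ^ 'n"
    and x_star :: "real ^ 'n"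
    and \<alpha> \<beta> \<kappa> \<eta> :: real
    and t :: nat
  assumes "compact X" and "convex X"
    and "\<alpha> > 0" and "\<beta> > 0"
    and "strongly_convex_on \<alpha> X f grad_f"
    and "beta_smooth_on \<beta> X f grad_f"
    and "\<kappa> = \<beta> / \<alpha>"
    and "is_arg_min f (\<lambda>y. y \<in> X) x_star"
    and "\<eta> = 1 / \<beta>"
    and "projected_gradient_descent X grad_f \<eta> x"
  shows "(norm (x (t + 1) - x_star))\<^sup>2 \<le> exp (- (real t / \<kappa>)) * (norm (x 1 - x_star))\<^sup>2"
proof (induction t)
  case 0
  show ?case
    by simp
next
  case (Suc t)
  note [simp] = \<open>\<kappa> = \<beta> / \<alpha>\<close>
  have "closed X"
    using \<open>compact X\<close> by (rule compact_imp_closed)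
  have step: "x (Suc t + 1) = closest_point X (x (t + 1) - (1 / \<beta>) *\<^sub>R grad_f (x (t + 1)))"
    using assms(9,10) by (simp add: projected_gradient_descent_def)
  have "(norm (x (Suc t + 1) - x_star))\<^sup>2 \<le> (1 - \<alpha> / \<beta>) * (norm (x (t + 1) - x_star))\<^sup>2"
    using projected_gradient_step_contraction[OF \<open>closed X\<close> assms(2,4-6,8) _ step]
      projected_gradient_descent_in_set[OF \<open>closed X\<close> assms(10)] by blast
  also have "\<dots> \<le> exp (- (\<alpha> / \<beta>)) * (norm (x (t + 1) - x_star))\<^sup>2"
    using exp_ge_add_one_self[of "- (\<alpha> / \<beta>)"] by (intro mult_right_mono) auto
  also have "\<dots> \<le> exp (- (\<alpha> / \<beta>)) * (exp (- (real t / \<kappa>)) * (norm (x 1 - x_star))\<^sup>2)"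
    by (intro mult_left_mono Suc.IH) auto
  also have "\<dots> = exp (- (real (Suc t) / \<kappa>)) * (norm (x 1 - x_star))\<^sup>2"
    by (simp add: exp_add[symmetric] add_divide_distrib algebra_simps)
  finally show ?case .
qed

end
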